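(* Let $\lambda=[\lambda_1,\ldots,\lambda_k]$ be a partition, $n$ a positive integer, and $v$ a strictly increasing vector of length $k$ with entries in $\{1,\ldots,n\}$. The vertices of $P(v,\lambda,n)$ are exactly the matrices in $M(v,\lambda,n)$.
   Context: A partition is a weakly decreasing sequence of positive integers $\lambda=[\lambda_1,\ldots,\lambda_k]$; $a_i$ is the number of parts equal to $i$. A sign matrix is a matrix with entries in $\{-1,0,1\}$ whose column partial sums from the top lie in $\{0,1\}$ and whose row partial sums from the left are nonnegative. $M(\lambda,n)$ is the set of $\lambda_1\times n$ sign matrices whose $i$-th row sums to $a_{\lambda_1-i+1}$. $M(v,\lambda,n)$ is the set of $M\in M(\lambda,n)$ whose $j$-th column sums to $1$ if $j$ is an entry of $v$ and to $0$ otherwise. $P(v,\lambda,n)$ is the convex hull of $M(v,\lambda,n)$ in $\mathbb{R}^{\lambda_1 n}$. *)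

theory Defs
  imports "HOL-Analysis.Analysis" "HOL-Analysis.Finite_Function_Topology"
begin

definition is_partition :: "nat list \<Rightarrow> bool" where
  "is_partition l \<longleftrightarrow> sorted_wrt (\<ge>) l \<and> (\<forall>x \<in> set l. 0 < x)"

text \<open>The first part \<open>\<lambda>\<^sub>1\<close>; it is 0 for the empty partition.\<close>
definition first_part :: "nat list \<Rightarrow> nat" where
  "first_part l = (if l = [] then 0 else hd l)"

text \<open>
  Since the size of the matrices depends on the partition, the space of real \<open>m \<times> n\<close> matrices
  is taken to be the linear subspace of those finitely supported functions on pairs
  (row, column), both counted from 1, whose support lies in \<open>{1..m} \<times> {1..n}\<close>.
  Being a copy of the \<open>m n\<close>-dimensional real space inside a real vector space, it has the
  same convex hulls and extreme points.
\<close>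
type_synonym rmat = "(nat \<times> nat) \<Rightarrow>\<^sub>0 real"

abbreviation entry :: "rmat \<Rightarrow> nat \<Rightarrow> nat \<Rightarrow> real" where
  "entry M i j \<equiv> Poly_Mapping.lookup M (i, j)"

definition matrices :: "nat \<Rightarrow> nat \<Rightarrow> rmat set" where
  "matrices m n = {M. Poly_Mapping.keys M \<subseteq> {1..m} \<times> {1..n}}"

definition sign_matrices :: "nat \<Rightarrow> nat \<Rightarrow> rmat set" where
  "sign_matrices m n = {M \<in> matrices m n.
     (\<forall>i \<in> {1..m}. \<forall>j \<in> {1..n}. entry M i j \<in> {-1, 0, 1}) \<and>
     (\<forall>i \<in> {1..m}. \<forall>j \<in> {1..n}. (\<Sum>i'=1..i. entry M i' j) \<in> {0, 1}) \<and>
     (\<forall>i \<in> {1..m}. \<forall>j \<in> {1..n}. 0 \<le> (\<Sum>j'=1..j. entry M i j'))}"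

text \<open>Row \<open>i\<close> sums to the multiplicity of the part \<open>\<lambda>\<^sub>1 - i + 1\<close>; this number is positive, so the
  subtraction of naturals does not truncate.\<close>
definition shape_sign_matrices :: "nat list \<Rightarrow> nat \<Rightarrow> rmat set" where
  "shape_sign_matrices l n = {M \<in> sign_matrices (first_part l) n.
     \<forall>i \<in> {1..first_part l}.
       (\<Sum>j=1..n. entry M i j) = real (count_list l (first_part l - i + 1))}"

definition column_shape_sign_matrices :: "nat list \<Rightarrow> nat list \<Rightarrow> nat \<Rightarrow> rmat set" where
  "column_shape_sign_matrices v l n = {M \<in> shape_sign_matrices l n.
     \<forall>j \<in> {1..n}. (\<Sum>i=1..first_part l. entry M i j) = (if j \<in> set v then 1 else 0)}"

definition sign_matrix_polytope :: "nat list \<Rightarrow> nat list \<Rightarrow> nat \<Rightarrow> rmat set" where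
  "sign_matrix_polytope v l n = convex hull (column_shape_sign_matrices v l n)"

end

theory Submission
  imports Defs
begin

text \<open>Taking partial column sums is linear and injective, and it sends every sign matrix to a
  0/1-array. A 0/1-point cannot be a proper convex combination of other points of the unit cube, so
  every matrix of the generating set is a vertex.\<close>

text \<open>The functionals \<open>f i\<close> act as the coordinates of an injective linear map
  into a cube. Keeping them as a separate family lets the argument run one coordinate at a time,
  with no space of arrays as codomain.\<close>

lemma extreme_point_of_convex_hull_zero_one:
  fixes f :: "'i \<Rightarrow> 'a::real_vector \<Rightarrow> real"
  assumes lin: "\<And>i. linear (f i)"
    and sep: "\<And>x y. (\<And>i. f i x = f i y) \<Longrightarrow> x = y"
    and S: "\<And>i x. x \<in> S \<Longrightarrow> f i x \<in> {0, 1}"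
    and x: "x \<in> S"
  shows "x extreme_point_of (convex hull S)"
proof -
  have bounds: "f i y \<in> {0..1}" if "y \<in> convex hull S" for i y
  proof -
    have "f i y \<in> convex hull (f i ` S)"
      using that convex_hull_linear_image[OF lin, of i S] by blast
    also have "\<dots> \<subseteq> {0..1}"
    proof (rule hull_minimal)
      show "f i ` S \<subseteq> {0..1}"
        using S[of _ i] by fastforce
    qed simp
    finally show ?thesis .
  qed
  have False if a: "a \<in> convex hull S" and b: "b \<in> convex hull S" and ab: "x \<in> open_segment a b"
    for a b
  proof -
    obtain u where "a \<noteq> b" and u: "0 < u" "u < 1" and xu: "x = (1 - u) *\<^sub>R a + u *\<^sub>R b"
      using ab by (auto simp: in_segment)
    have "f i a = f i b" for i
    proof (rule ccontr)
      assume "f i a \<noteq> f i b"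
      \<comment> \<open>Where the endpoints differ, \<open>f i x\<close> lies strictly between two
        numbers of the unit interval, so it can be neither 0 nor 1.\<close>
      then have "f i x \<in> open_segment (f i a) (f i b)"
        using u by (auto simp: in_segment xu linear_add[OF lin] linear_scale[OF lin])
      then show False
        using bounds[OF a, of i] bounds[OF b, of i] S[OF x, of i]
        by (auto simp: open_segment_eq_real_ivl split: if_splits)
    qed
    then show False
      using sep \<open>a \<noteq> b\<close> by blast
  qed
  then show ?thesis
    using x by (auto simp: extreme_point_of_def hull_inc)
qed

text \<open>Summation starts at row 0 and the index ranges over all pairs, so that the family
  separates all of \<open>rmat\<close>, not just matrices of a fixed size.\<close>

definition column_partial_sum :: "nat \<times> nat \<Rightarrow> rmat \<Rightarrow> real" where
  "column_partial_sum = (\<lambda>(i, j) M. \<Sum>i'\<le>i. entry M i' j)"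

lemma lookup_scaleR: "Poly_Mapping.lookup (c *\<^sub>R M) p = c *\<^sub>R Poly_Mapping.lookup M p"
proof -
  \<comment> \<open>Scaling is defined through \<open>Abs_poly_mapping\<close>, which can be
    inverted only at functions of finite support.\<close>
  have "finite {p. c *\<^sub>R Poly_Mapping.lookup M p \<noteq> 0}"
    by (rule finite_subset[OF _ finite_keys[of M]]) (auto simp: in_keys_iff)
  then show ?thesis
    by (simp add: scaleR_poly_mapping_def Abs_poly_mapping_inverse)
qed

lemma linear_column_partial_sum: "linear (column_partial_sum p)"
  by (rule linearI)
    (auto simp: column_partial_sum_def lookup_add lookup_scaleR sum.distrib sum_distrib_left split: prod.split)

text \<open>An entry is the difference of two consecutive partial sums in its column; in row 0 it is
  itself the partial sum.\<close>

lemma column_partial_sum_eqD: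
  assumes "\<And>p. column_partial_sum p M = column_partial_sum p N"
  shows "M = N"
proof (rule poly_mapping_eqI)
  fix p :: "nat \<times> nat"
  obtain i j where p: "p = (i, j)" by (cases p)
  show "Poly_Mapping.lookup M p = Poly_Mapping.lookup N p"
    using assms[of "(i, j)"] assms[of "(i - 1, j)"]
    by (cases i) (simp_all add: p column_partial_sum_def)
qed

lemma column_partial_sum_sign_matrix:
  assumes "M \<in> sign_matrices m n"
  shows "column_partial_sum p M \<in> {0, 1}"
proof -
  obtain i j where p: "p = (i, j)" by (cases p)
  have zero: "entry M i' j = 0" if "i' \<notin> {1..m} \<or> j \<notin> {1..n}" for i'
    using assms that by (auto simp: sign_matrices_def matrices_def in_keys_iff subset_iff)
  \<comment> \<open>Row 0 and the rows below \<open>m\<close> contribute only zeros, which reduces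
    the sum to the range that the sign condition covers.\<close>
  have eq: "column_partial_sum p M = (\<Sum>i'=1..min i m. entry M i' j)"
    unfolding p column_partial_sum_def prod.case
    by (rule sum.mono_neutral_right) (auto intro: zero)
  show ?thesis
  proof (cases "j \<in> {1..n} \<and> min i m \<in> {1..m}")
    case True
    then show ?thesis
      using assms unfolding eq sign_matrices_def by blast
  next
    \<comment> \<open>Either column \<open>j\<close> lies outside the matrix and vanishes, or
      \<open>min i m\<close> is 0 and the sum is empty; \<open>m\<close> is 0 for the empty
      partition.\<close>
    case False
    then have "(\<Sum>i'=1..min i m. entry M i' j) = 0"
      by (intro sum.neutral ballI zero) auto
    then show ?thesis
      by (simp add: eq)
  qed
qed

theorem theorem9p7:
  fixes l v :: "nat list" and n :: nat
  assumes "is_partition l"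
    and "0 < n"
    and "sorted_wrt (<) v" and "length v = length l" and "set v \<subseteq> {1..n}"
  shows "{M. M extreme_point_of sign_matrix_polytope v l n} = column_shape_sign_matrices v l n"
proof
  show "{M. M extreme_point_of sign_matrix_polytope v l n} \<subseteq> column_shape_sign_matrices v l n"
    \<comment> \<open>An extreme point of the convex hull of any set belongs to that set.\<close>
    unfolding sign_matrix_polytope_def by (auto dest: extreme_point_of_convex_hull)
  show "column_shape_sign_matrices v l n \<subseteq> {M. M extreme_point_of sign_matrix_polytope v l n}"
  proof (intro subsetI CollectI)
    fix M
    assume "M \<in> column_shape_sign_matrices v l n"
    moreover have "column_partial_sum p N \<in> {0, 1}" if "N \<in> column_shape_sign_matrices v l n" for p N
      using that
      by (intro column_partial_sum_sign_matrix[where m = "first_part l" and n = n])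
        (simp add: column_shape_sign_matrices_def shape_sign_matrices_def)
    ultimately show "M extreme_point_of sign_matrix_polytope v l n"
      unfolding sign_matrix_polytope_def
      by (intro extreme_point_of_convex_hull_zero_one[of column_partial_sum]
          linear_column_partial_sum column_partial_sum_eqD)
  qed
qed

end
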